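(* Let $R$ be a commutative Bézout domain (with $1\neq 0$) of stable range $1.5$, let $m\in R$ be a nonzero nonunit, and let $R_m=R/mR$. Let $a,b\in R_m$. Then: (i) if the linear equation $b=ax$ is solvable in $R_m$, then it has at least one generating solution; (ii) if the linear equation $b=ax$ is solvable in $R_m$, then any two of its generating solutions are associates in $R_m$.
   Context: $(a_1,\dots,a_k)$ denotes the greatest common divisor (determined up to a unit). A commutative ring $R$ has stable range $1.5$ if for all $a,b\in R$ and $c\in R\setminus\{0\}$ with $(a,b,c)=1$ there exists $r\in R$ such that $(a+br,c)=1$. In a commutative ring, $a\mid b$ means $b=ac$ for some $c$ in the ring. A generating solution of a solvable equation $b=ax$ in $R_m$ is a solution $x_0\in R_m$ which divides (in $R_m$) every solution of the equation. Two elements $f,g\in R_m$ are associates if $f=ge$ for some unit $e$ of $R_m$. *)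

theory Defs
  imports "HOL-Algebra.Algebra"
begin

locale bezout_domain = domain R for R (structure) +
  assumes finitely_generated_principal:
    "\<lbrakk>finite S; S \<subseteq> carrier R\<rbrakk> \<Longrightarrow> principalideal (Idl S) R"

text \<open>The set-indexed version of \<^const>\<open>isgcd\<close>. Since gcds are determined only up to units,
  ``the gcd is \<open>1\<close>'' is rendered as ``\<open>\<one>\<close> is a gcd''.\<close>

definition is_gcd_of :: "('a, _) ring_scheme \<Rightarrow> 'a \<Rightarrow> 'a set \<Rightarrow> bool"
  where "is_gcd_of R d S \<longleftrightarrow> d \<in> carrier R \<and> (\<forall>s\<in>S. d divides\<^bsub>R\<^esub> s) \<and>
    (\<forall>e\<in>carrier R. (\<forall>s\<in>S. e divides\<^bsub>R\<^esub> s) \<longrightarrow> e divides\<^bsub>R\<^esub> d)"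

lemma is_gcd_of_pair: "is_gcd_of R d {a, b} \<longleftrightarrow> d \<in> carrier R \<and> d gcdof\<^bsub>R\<^esub> a b"
  by (auto simp: is_gcd_of_def isgcd_def)

definition stable_range_1_5 :: "('a, _) ring_scheme \<Rightarrow> bool"
  where "stable_range_1_5 R \<longleftrightarrow>
    (\<forall>a\<in>carrier R. \<forall>b\<in>carrier R. \<forall>c\<in>carrier R - {\<zero>\<^bsub>R\<^esub>}.
      is_gcd_of R \<one>\<^bsub>R\<^esub> {a, b, c} \<longrightarrow>
      (\<exists>r\<in>carrier R. is_gcd_of R \<one>\<^bsub>R\<^esub> {a \<oplus>\<^bsub>R\<^esub> b \<otimes>\<^bsub>R\<^esub> r, c}))"

definition solutions :: "('a, _) ring_scheme \<Rightarrow> 'a \<Rightarrow> 'a \<Rightarrow> 'a set"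
  where "solutions S a b = {x \<in> carrier S. b = a \<otimes>\<^bsub>S\<^esub> x}"

definition generating_solution :: "('a, _) ring_scheme \<Rightarrow> 'a \<Rightarrow> 'a \<Rightarrow> 'a \<Rightarrow> bool"
  where "generating_solution S a b x\<^sub>0 \<longleftrightarrow>
    x\<^sub>0 \<in> solutions S a b \<and> (\<forall>x\<in>solutions S a b. x\<^sub>0 divides\<^bsub>S\<^esub> x)"

text \<open>The library's \<^const>\<open>associated\<close> means mutual divisibility, which in a ring with zero divisors
  need not imply being unit multiples of each other.\<close>

definition unit_associates :: "('a, _) ring_scheme \<Rightarrow> 'a \<Rightarrow> 'a \<Rightarrow> bool"
  where "unit_associates S f g \<longleftrightarrow> (\<exists>e\<in>Units S. f = g \<otimes>\<^bsub>S\<^esub> e)"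

end

theory Submission
  imports Defs
begin

text \<open>
  Both parts rest on one use of stable range 1.5 (\<open>gcd_times_coprime_in_progression\<close>): if
  \<open>q\<close> divides \<open>c \<noteq> 0\<close> and \<open>d\<close> is a gcd of \<open>p\<close> and \<open>q\<close>, then the progression \<open>p + qR\<close> contains an
  element \<open>d e\<close> with \<open>e\<close> coprime to \<open>c\<close>. For \<open>c = m\<close> the residue of \<open>e\<close> is a unit of \<open>R/mR\<close>, so
  \<open>d e\<close> and \<open>d\<close> differ there by a unit only.

  Existence. The residues annihilated by \<open>a\<close> are the multiples of a divisor \<open>n\<close> of \<open>m\<close>
  (\<open>colon_ideal_principal\<close>). If \<open>p\<close> represents one solution of \<open>b = a x\<close>, then the solutions are the
  residues of the progression \<open>p + nR\<close>, all of which are multiples of \<open>d = (p, n)\<close>. The lemma, with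
  \<open>q = n\<close>, finds a solution \<open>d e\<close> that is itself a unit multiple of \<open>d\<close> modulo \<open>m\<close>, hence divides
  every solution.

  Uniqueness. Generating solutions divide each other, but \<open>R/mR\<close> has zero divisors, so this alone
  does not make them unit multiples of each other. The lemma, now with \<open>q = m\<close>, shows that every
  element of \<open>R/mR\<close> is a unit times the residue of a divisor of \<open>m\<close> (\<open>gcd_normal_form\<close>). Divisibility
  between residues of divisors of \<open>m\<close> lifts to \<open>R\<close>, and \<open>R\<close> is a domain, where mutual
  divisibility does give a unit factor.
\<close>

section \<open>Gcds in a Bezout domain\<close>

context bezout_domain
begin

lemma bezout_identity:
  assumes "p \<in> carrier R" "q \<in> carrier R"
  obtains d u v s t where
    "d \<in> carrier R" "u \<in> carrier R" "v \<in> carrier R" "s \<in> carrier R" "t \<in> carrier R"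
    "p = d \<otimes> u" "q = d \<otimes> v" "p \<otimes> s \<oplus> q \<otimes> t = d"
proof -
  interpret principalideal "Idl {p, q}" R
    using assms by (intro finitely_generated_principal) auto
  obtain d where d: "d \<in> carrier R" "Idl {p, q} = PIdl d"
    using generate cgenideal_eq_genideal by metis
  have "{p, q} \<subseteq> PIdl d"
    using assms genideal_self[of "{p, q}"] d by simp
  then obtain u v where uv: "u \<in> carrier R" "p = d \<otimes> u" "v \<in> carrier R" "q = d \<otimes> v"
    using d(1) by (auto simp: cgenideal_def m_comm)
  have "ideal (PIdl p <+>\<^bsub>R\<^esub> PIdl q) R"
    using assms by (intro add_ideals cgenideal_ideal)
  moreover have "p \<in> PIdl p <+>\<^bsub>R\<^esub> PIdl q"
  proof -
    have "p = p \<oplus> \<zero> \<otimes> q" using assms by simp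
    then show ?thesis
      using assms cgenideal_self[of p] unfolding set_add_def' cgenideal_def by blast
  qed
  moreover have "q \<in> PIdl p <+>\<^bsub>R\<^esub> PIdl q"
  proof -
    have "q = \<zero> \<otimes> p \<oplus> q" using assms by simp
    then show ?thesis
      using assms cgenideal_self[of q] unfolding set_add_def' cgenideal_def by blast
  qed
  ultimately have "Idl {p, q} \<subseteq> PIdl p <+>\<^bsub>R\<^esub> PIdl q"
    by (intro genideal_minimal) auto
  then have "d \<in> PIdl p <+>\<^bsub>R\<^esub> PIdl q"
    using d cgenideal_self[of d] by auto
  then obtain s t where "s \<in> carrier R" "t \<in> carrier R" "p \<otimes> s \<oplus> q \<otimes> t = d"
    using assms by (auto simp: set_add_def' cgenideal_def m_comm)
  with d uv show thesis using that by metis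
qed

lemma coprime_bezout_identity:
  assumes "p \<in> carrier R" "q \<in> carrier R" "is_gcd_of R \<one> {p, q}"
  obtains s t where "s \<in> carrier R" "t \<in> carrier R" "p \<otimes> s \<oplus> q \<otimes> t = \<one>"
proof -
  obtain d u v s t where d: "d \<in> carrier R" "u \<in> carrier R" "v \<in> carrier R"
      "s \<in> carrier R" "t \<in> carrier R" "p = d \<otimes> u" "q = d \<otimes> v" "p \<otimes> s \<oplus> q \<otimes> t = d"
    by (rule bezout_identity[OF assms(1,2)])
  have "d divides p" "d divides q"
    using d(1-3,6,7) by (auto intro: dividesI)
  then have "d divides \<one>"
    using assms(3) d(1) by (auto simp: is_gcd_of_def)
  then obtain k where k: "k \<in> carrier R" "\<one> = d \<otimes> k"
    by (auto elim: dividesE)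
  have "p \<otimes> (s \<otimes> k) \<oplus> q \<otimes> (t \<otimes> k) = (p \<otimes> s \<oplus> q \<otimes> t) \<otimes> k"
    using assms(1,2) d(4,5) k(1) by algebra
  then have "p \<otimes> (s \<otimes> k) \<oplus> q \<otimes> (t \<otimes> k) = \<one>"
    using d(8) k(2) by simp
  then show thesis using that[of "s \<otimes> k" "t \<otimes> k"] d(4,5) k(1) by simp
qed

text \<open>
  Write \<open>p = d u\<close> and \<open>q = d v\<close>. Cancelling \<open>d\<close> in \<open>d = p s + q t\<close> shows that \<open>u\<close> and \<open>v\<close> are
  coprime, so stable range 1.5 applies to \<open>u, v, c\<close> and makes some \<open>e = u + v r\<close> coprime to \<open>c\<close>.
  The assumption that \<open>q\<close> divides \<open>c\<close> serves to make \<open>q\<close>, and therefore \<open>d\<close>, nonzero.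
\<close>

lemma gcd_times_coprime_in_progression:
  assumes "stable_range_1_5 R" "c \<in> carrier R" "c \<noteq> \<zero>"
    and "p \<in> carrier R" "q \<in> carrier R" "q divides c"
  obtains d r e where "d \<in> carrier R" "r \<in> carrier R" "e \<in> carrier R"
    "d divides p" "d divides q" "p \<oplus> q \<otimes> r = d \<otimes> e" "is_gcd_of R \<one> {e, c}"
proof -
  obtain d u v s t where d: "d \<in> carrier R" "u \<in> carrier R" "v \<in> carrier R"
      "s \<in> carrier R" "t \<in> carrier R" "p = d \<otimes> u" "q = d \<otimes> v" "p \<otimes> s \<oplus> q \<otimes> t = d"
    by (rule bezout_identity[OF assms(4,5)])
  have "q \<noteq> \<zero>"
    using assms by (auto elim!: dividesE)
  then have "d \<noteq> \<zero>"
    using d(3,7) by auto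
  have "d \<otimes> (u \<otimes> s \<oplus> v \<otimes> t) = (d \<otimes> u) \<otimes> s \<oplus> (d \<otimes> v) \<otimes> t"
    using d(1-5) by algebra
  also have "\<dots> = d \<otimes> \<one>"
    using d(1) by (simp flip: d(6,7) add: d(8))
  finally have one: "u \<otimes> s \<oplus> v \<otimes> t = \<one>"
    by (rule m_lcancel[THEN iffD1, rotated 4]) (use d(1-5) \<open>d \<noteq> \<zero>\<close> in auto)
  have "is_gcd_of R \<one> {u, v, c}"
    unfolding is_gcd_of_def
  proof (intro conjI ballI impI)
    fix z assume z: "z \<in> carrier R" "\<forall>y\<in>{u, v, c}. z divides y"
    then obtain u' v' where "u' \<in> carrier R" "u = z \<otimes> u'" "v' \<in> carrier R" "v = z \<otimes> v'"
      by (auto elim!: dividesE)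
    moreover from this have "u \<otimes> s \<oplus> v \<otimes> t = z \<otimes> (u' \<otimes> s \<oplus> v' \<otimes> t)"
      using z(1) d(4,5) by (simp add: m_assoc r_distr)
    ultimately show "z divides \<one>"
      using one d(4,5) by (auto intro!: dividesI[of "u' \<otimes> s \<oplus> v' \<otimes> t"])
  qed (use d(2,3) assms(2) in \<open>auto intro: dividesI\<close>)
  then obtain r where r: "r \<in> carrier R" "is_gcd_of R \<one> {u \<oplus> v \<otimes> r, c}"
    using assms(1-3) d(2,3) unfolding stable_range_1_5_def by blast
  have "d \<otimes> u \<oplus> d \<otimes> v \<otimes> r = d \<otimes> (u \<oplus> v \<otimes> r)"
    using d(1-3) r(1) by (simp add: m_assoc r_distr)
  then have "p \<oplus> q \<otimes> r = d \<otimes> (u \<oplus> v \<otimes> r)"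
    using d(6,7) by simp
  moreover have "d divides p" "d divides q"
    using d(1-3,6,7) by (auto intro: dividesI)
  ultimately show thesis
    using d(1-3) r that[of d r "u \<oplus> v \<otimes> r"] by simp
qed

text \<open>
  The witness is \<open>n = m / g\<close> for a gcd \<open>g\<close> of \<open>a\<close> and \<open>m\<close>. The elements \<open>y\<close> with \<open>a y \<in> mR\<close> are
  those whose residues modulo \<open>m\<close> are annihilated by \<open>a\<close>.
\<close>

lemma colon_ideal_principal:
  assumes "a \<in> carrier R" "m \<in> carrier R" "m \<noteq> \<zero>"
  obtains n where "n \<in> carrier R" "n divides m"
    "\<And>y. y \<in> carrier R \<Longrightarrow> m divides a \<otimes> y \<longleftrightarrow> n divides y"
proof -
  obtain g a' n s t where g: "g \<in> carrier R" "a' \<in> carrier R" "n \<in> carrier R"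
      "s \<in> carrier R" "t \<in> carrier R" "a = g \<otimes> a'" "m = g \<otimes> n" "a \<otimes> s \<oplus> m \<otimes> t = g"
    by (rule bezout_identity[OF assms(1,2)])
  have "g \<noteq> \<zero>"
    using assms(3) g(3,7) by auto
  have "m divides a \<otimes> y \<longleftrightarrow> n divides y" if y: "y \<in> carrier R" for y
  proof
    assume "m divides a \<otimes> y"
    then obtain k where k: "k \<in> carrier R" "a \<otimes> y = m \<otimes> k"
      by (auto elim: dividesE)
    \<comment> \<open>Multiplying \<open>g = a s + m t\<close> by \<open>y\<close> makes both terms multiples of \<open>m = g n\<close>.\<close>
    have "g \<otimes> y = (a \<otimes> y) \<otimes> s \<oplus> m \<otimes> (t \<otimes> y)"
      by (subst g(8)[symmetric]) (use assms(1,2) g(4,5) y in algebra)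
    also have "\<dots> = m \<otimes> (k \<otimes> s \<oplus> t \<otimes> y)"
      using k assms(2) g(4,5) y by (simp add: m_assoc r_distr)
    also have "\<dots> = g \<otimes> (n \<otimes> (k \<otimes> s \<oplus> t \<otimes> y))"
      by (subst g(7)) (use k(1) g(1-5) y in \<open>simp add: m_assoc\<close>)
    finally have "y = n \<otimes> (k \<otimes> s \<oplus> t \<otimes> y)"
      by (rule m_lcancel[THEN iffD1, rotated 4]) (use \<open>g \<noteq> \<zero>\<close> k(1) g(1-5) y in auto)
    then show "n divides y"
      using k(1) g(4,5) y by (intro dividesI[of "k \<otimes> s \<oplus> t \<otimes> y"]) auto
  next
    assume "n divides y"
    then obtain k where k: "k \<in> carrier R" "y = n \<otimes> k"
      by (auto elim: dividesE)
    have "(g \<otimes> a') \<otimes> (n \<otimes> k) = (g \<otimes> n) \<otimes> (a' \<otimes> k)"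
      using g(1-3) k(1) by algebra
    then have "a \<otimes> y = m \<otimes> (a' \<otimes> k)"
      using g(6,7) k(2) by simp
    then show "m divides a \<otimes> y"
      using g(2) k(1) by (intro dividesI[of "a' \<otimes> k"]) auto
  qed
  moreover have "n divides m"
    using g(1,3,7) by (intro dividesI[of g]) (auto simp: m_comm)
  ultimately show thesis using that[of n] g(3) by blast
qed

end

section \<open>Residues modulo a nonzero element\<close>

locale principal_quotient = bezout_domain R for R (structure) +
  fixes m S h
  assumes m: "m \<in> carrier R" "m \<noteq> \<zero>"
  defines "S \<equiv> R Quot (PIdl m)"
    and "h \<equiv> (\<lambda>x. PIdl m +> x)"
begin

sublocale I: ideal "PIdl m" R
  using m(1) by (rule cgenideal_ideal)

sublocale h: ring_hom_cring R S h
  unfolding S_def h_def by (rule I.rcos_ring_hom_cring) (rule is_cring)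

lemma residue_surj:
  assumes "z \<in> carrier S"
  obtains x where "x \<in> carrier R" "z = h x"
  using assms unfolding S_def h_def FactRing_def A_RCOSETS_def' by auto

lemma residue_eq_iff:
  assumes "x \<in> carrier R" "y \<in> carrier R"
  shows "h x = h y \<longleftrightarrow> m divides (x \<ominus> y)"
proof -
  have "h x = h y \<longleftrightarrow> x \<ominus> y \<in> PIdl m"
    unfolding h_def using assms quotient_eq_iff_same_a_r_cos[OF I.is_ideal] by simp
  also have "\<dots> \<longleftrightarrow> (\<exists>k\<in>carrier R. x \<ominus> y = k \<otimes> m)"
    unfolding cgenideal_def by blast
  also have "\<dots> \<longleftrightarrow> m divides (x \<ominus> y)"
    unfolding factor_def using m(1) m_comm by metis
  finally show ?thesis .
qed

lemma residue_zero_iff: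
  assumes "x \<in> carrier R"
  shows "h x = \<zero>\<^bsub>S\<^esub> \<longleftrightarrow> m divides x"
  using residue_eq_iff[OF assms zero_closed] assms by (simp add: minus_eq)

lemma residue_unit:
  assumes "e \<in> carrier R" "is_gcd_of R \<one> {e, m}"
  shows "h e \<in> Units S"
proof -
  obtain s t where st: "s \<in> carrier R" "t \<in> carrier R" "e \<otimes> s \<oplus> m \<otimes> t = \<one>"
    by (rule coprime_bezout_identity[OF assms(1) m(1) assms(2)])
  have "h (m \<otimes> t) = \<zero>\<^bsub>S\<^esub>"
    using m(1) st by (subst residue_zero_iff) (auto intro: dividesI)
  then have "h e \<otimes>\<^bsub>S\<^esub> h s = h (e \<otimes> s \<oplus> m \<otimes> t)"
    using assms(1) m(1) st(1,2) by (simp del: h.hom_mult add: h.hom_mult[symmetric])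
  then have "\<one>\<^bsub>S\<^esub> = h e \<otimes>\<^bsub>S\<^esub> h s"
    using st(3) by simp
  then have "h e divides\<^bsub>S\<^esub> \<one>\<^bsub>S\<^esub>"
    by (rule dividesI[rotated]) (rule h.hom_closed[OF st(1)])
  then show ?thesis
    by (rule h.S.divides_unit) (simp_all add: assms(1))
qed

text \<open>
  A representative \<open>p\<close> of \<open>z\<close> may be moved within \<open>p + mR\<close>, and that progression contains an
  element \<open>d e\<close> with \<open>d\<close> a gcd of \<open>p\<close> and \<open>m\<close> and with \<open>e\<close> coprime to \<open>m\<close>.
\<close>

lemma gcd_normal_form:
  assumes "stable_range_1_5 R" "z \<in> carrier S"
  obtains d \<epsilon> where "d \<in> carrier R" "d divides m" "\<epsilon> \<in> Units S" "z = h d \<otimes>\<^bsub>S\<^esub> \<epsilon>"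
proof -
  obtain p where p: "p \<in> carrier R" "z = h p"
    using residue_surj[OF assms(2)] .
  obtain d r e where d: "d \<in> carrier R" "r \<in> carrier R" "e \<in> carrier R" "d divides m"
      "p \<oplus> m \<otimes> r = d \<otimes> e" "is_gcd_of R \<one> {e, m}"
    by (rule gcd_times_coprime_in_progression[OF assms(1) m p(1) m(1) divides_refl[OF m(1)]])
  have "h m = \<zero>\<^bsub>S\<^esub>"
    using m(1) by (simp add: residue_zero_iff)
  then have "z = h (p \<oplus> m \<otimes> r)"
    using p m(1) d(2) by simp
  then have "z = h d \<otimes>\<^bsub>S\<^esub> h e"
    using d(1,3,5) by simp
  with d residue_unit show thesis using that by blast
qed

text \<open>
  If \<open>x\<close> is a multiple of \<open>d\<close> modulo \<open>m\<close> and \<open>m\<close> is itself a multiple of \<open>d\<close>, the error term is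
  harmless.
\<close>

lemma divisor_of_modulus_reflects_divides:
  assumes "d \<in> carrier R" "d divides m" "x \<in> carrier R" "h d divides\<^bsub>S\<^esub> h x"
  shows "d divides x"
proof -
  obtain k where k: "k \<in> carrier R" "h x = h d \<otimes>\<^bsub>S\<^esub> h k"
    using assms(4) by (metis dividesE residue_surj)
  then have "m divides (x \<ominus> d \<otimes> k)"
    using assms by (simp add: residue_eq_iff[symmetric])
  then have "d divides (x \<ominus> d \<otimes> k)"
    using assms(1,2) divides_trans by blast
  then obtain j where j: "j \<in> carrier R" "x \<ominus> d \<otimes> k = d \<otimes> j"
    by (auto elim: dividesE)
  have "x = (x \<ominus> d \<otimes> k) \<oplus> d \<otimes> k"
    using assms(1,3) k(1) by algebra
  also have "\<dots> = d \<otimes> (j \<oplus> k)"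
    using assms(1) j k(1) by (simp add: r_distr)
  finally show ?thesis
    using j(1) k(1) by (intro dividesI[of "j \<oplus> k"]) auto
qed

text \<open>
  Replacing \<open>x\<close> and \<open>y\<close> by divisors \<open>d\<close> and \<open>d'\<close> of \<open>m\<close>, up to units, moves the mutual
  divisibility into the domain \<open>R\<close>, where it yields a unit \<open>w\<close> with \<open>d = w d'\<close>; the residue of
  \<open>w\<close> is again a unit.
\<close>

lemma mutual_divisors_unit_associates:
  assumes "stable_range_1_5 R"
    and x: "x \<in> carrier S" and y: "y \<in> carrier S"
    and "x divides\<^bsub>S\<^esub> y" "y divides\<^bsub>S\<^esub> x"
  shows "unit_associates S x y"
proof -
  obtain d \<epsilon> where d: "d \<in> carrier R" "d divides m" "\<epsilon> \<in> Units S" "x = h d \<otimes>\<^bsub>S\<^esub> \<epsilon>"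
    by (rule gcd_normal_form[OF assms(1) x])
  obtain d' \<epsilon>' where d': "d' \<in> carrier R" "d' divides m" "\<epsilon>' \<in> Units S" "y = h d' \<otimes>\<^bsub>S\<^esub> \<epsilon>'"
    by (rule gcd_normal_form[OF assms(1) y])
  have "x \<sim>\<^bsub>S\<^esub> h d" "y \<sim>\<^bsub>S\<^esub> h d'"
    using h.S.associatedI2[OF d(3,4)] h.S.associatedI2[OF d'(3,4)] d(1) d'(1) by simp_all
  then have "h d divides\<^bsub>S\<^esub> h d'" "h d' divides\<^bsub>S\<^esub> h d"
    using assms(4,5) d d' x y
    by (meson associatedD h.S.associated_sym h.S.divides_trans h.hom_closed)+
  then have "d divides d'" "d' divides d"
    using d(1,2) d'(1,2) divisor_of_modulus_reflects_divides by blast+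
  then obtain w where w: "w \<in> Units R" "d = w \<otimes> d'"
    using d(1) d'(1) ring_associated_iff by (metis associatedI)
  then have "h d = h d' \<otimes>\<^bsub>S\<^esub> h w"
    using d'(1) by (simp add: Units_closed h.S.m_comm)
  have hw: "h w \<in> Units S"
  proof -
    have "h (w \<otimes> inv w) = \<one>\<^bsub>S\<^esub>"
      using w(1) by simp
    then have "\<one>\<^bsub>S\<^esub> = h w \<otimes>\<^bsub>S\<^esub> h (inv w)"
      using h.hom_mult[OF Units_closed[OF w(1)] Units_inv_closed[OF w(1)]] by simp
    then have "h w divides\<^bsub>S\<^esub> \<one>\<^bsub>S\<^esub>"
      by (rule dividesI[rotated]) (use w(1) in simp)
    then show ?thesis
      by (rule h.S.divides_unit) (simp_all add: Units_closed w(1))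
  qed
  have "h d' = y \<otimes>\<^bsub>S\<^esub> inv\<^bsub>S\<^esub> \<epsilon>'"
    using d'(1,3,4) by (simp add: h.S.m_assoc h.S.Units_closed)
  then have "x = y \<otimes>\<^bsub>S\<^esub> (inv\<^bsub>S\<^esub> \<epsilon>' \<otimes>\<^bsub>S\<^esub> h w \<otimes>\<^bsub>S\<^esub> \<epsilon>)"
    using d(3,4) d'(3) hw y \<open>h d = h d' \<otimes>\<^bsub>S\<^esub> h w\<close>
    by (simp add: h.S.m_assoc h.S.Units_closed)
  moreover have "inv\<^bsub>S\<^esub> \<epsilon>' \<otimes>\<^bsub>S\<^esub> h w \<otimes>\<^bsub>S\<^esub> \<epsilon> \<in> Units S"
    using d(3) d'(3) hw by simp
  ultimately show ?thesis
    unfolding unit_associates_def by blast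
qed

section \<open>Generating solutions\<close>

text \<open>
  The solutions form a progression \<open>p + nR\<close> modulo \<open>m\<close>, with \<open>n\<close> a divisor of \<open>m\<close>, and a
  gcd \<open>d\<close> of \<open>p\<close> and \<open>n\<close> divides all of its members. The generating solution is a member that is
  \<open>d\<close> times a unit modulo \<open>m\<close>.
\<close>

lemma ex_generating_solution:
  assumes sr: "stable_range_1_5 R"
    and a: "a \<in> carrier S" and "solutions S a b \<noteq> {}"
  shows "\<exists>x. generating_solution S a b x"
proof -
  obtain \<alpha> where \<alpha>: "\<alpha> \<in> carrier R" "a = h \<alpha>"
    using residue_surj[OF a] .
  obtain x where "x \<in> carrier S" "b = a \<otimes>\<^bsub>S\<^esub> x"
    using assms(3) unfolding solutions_def by blast
  then obtain p where p: "p \<in> carrier R" "b = a \<otimes>\<^bsub>S\<^esub> h p"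
    by (metis residue_surj)
  obtain n where n: "n \<in> carrier R" "n divides m"
      "\<And>y. y \<in> carrier R \<Longrightarrow> m divides \<alpha> \<otimes> y \<longleftrightarrow> n divides y"
    using colon_ideal_principal[OF \<alpha>(1) m] by blast
  have solution_iff: "h y \<in> solutions S a b \<longleftrightarrow> n divides (y \<ominus> p)" if y: "y \<in> carrier R" for y
  proof -
    have "h y \<in> solutions S a b \<longleftrightarrow> h (\<alpha> \<otimes> y) = h (\<alpha> \<otimes> p)"
      using p \<alpha> y by (simp add: solutions_def eq_commute)
    also have "\<dots> \<longleftrightarrow> m divides (\<alpha> \<otimes> y \<ominus> \<alpha> \<otimes> p)"
      using p \<alpha> y by (intro residue_eq_iff) auto
    also have "\<alpha> \<otimes> y \<ominus> \<alpha> \<otimes> p = \<alpha> \<otimes> (y \<ominus> p)"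
      using p \<alpha> y by algebra
    finally show ?thesis
      using p y n(3)[of "y \<ominus> p"] by simp
  qed
  obtain d r e where d: "d \<in> carrier R" "r \<in> carrier R" "e \<in> carrier R"
      "d divides p" "d divides n" "p \<oplus> n \<otimes> r = d \<otimes> e" "is_gcd_of R \<one> {e, m}"
    by (rule gcd_times_coprime_in_progression[OF sr m p(1) n(1,2)])
  have e: "h e \<in> Units S"
    using d residue_unit by blast
  \<comment> \<open>The element \<open>d e = p + n r\<close> lies in the progression, so its residue is a solution.\<close>
  have "(p \<oplus> n \<otimes> r) \<ominus> p = n \<otimes> r"
    using p n(1) d(2) by algebra
  then have "n divides ((p \<oplus> n \<otimes> r) \<ominus> p)"
    using d(2) by (simp add: dividesI[of r])
  then have "h (p \<oplus> n \<otimes> r) \<in> solutions S a b"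
    using solution_iff[of "p \<oplus> n \<otimes> r"] n(1) p(1) d(2) by blast
  then have "h (d \<otimes> e) \<in> solutions S a b"
    using d(6) by metis
  moreover have "h (d \<otimes> e) divides\<^bsub>S\<^esub> x" if x: "x \<in> solutions S a b" for x
  proof -
    obtain y where y: "y \<in> carrier R" "x = h y"
      using x unfolding solutions_def by (metis (lifting) mem_Collect_eq residue_surj)
    have "n divides (y \<ominus> p)"
      using x y solution_iff by simp
    then have "d divides (y \<ominus> p)"
      using d divides_trans by blast
    then obtain j k where jk: "j \<in> carrier R" "y \<ominus> p = d \<otimes> j" "k \<in> carrier R" "p = d \<otimes> k"
      using d(4) unfolding factor_def by blast
    have "y = (y \<ominus> p) \<oplus> p"
      using y p by algebra
    also have "\<dots> = d \<otimes> j \<oplus> d \<otimes> k"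
      unfolding jk(2) by (simp flip: jk(4))
    finally have "y = d \<otimes> (j \<oplus> k)"
      using d(1) jk(1,3) by (simp add: r_distr)
    then have "x = h d \<otimes>\<^bsub>S\<^esub> h (j \<oplus> k)"
      using d(1) jk(1,3) y by simp
    also have "\<dots> = h (d \<otimes> e) \<otimes>\<^bsub>S\<^esub> (inv\<^bsub>S\<^esub> (h e) \<otimes>\<^bsub>S\<^esub> h (j \<oplus> k))"
      using d jk(1,3) e by (simp add: h.S.m_assoc h.S.Units_closed flip: h.S.m_assoc[of "h e"])
    finally show ?thesis
      using jk e by (intro dividesI) auto
  qed
  ultimately show ?thesis
    unfolding generating_solution_def by blast
qed

end

theorem theorem1:
  fixes R :: "('a, 'b) ring_scheme" and m :: 'a and a b :: "'a set"
  assumes "bezout_domain R"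
    and "stable_range_1_5 R"
    and "m \<in> carrier R" and "m \<noteq> \<zero>\<^bsub>R\<^esub>" and "m \<notin> Units R"
    and "a \<in> carrier (R Quot (PIdl\<^bsub>R\<^esub> m))"
    and "b \<in> carrier (R Quot (PIdl\<^bsub>R\<^esub> m))"
  shows "(solutions (R Quot (PIdl\<^bsub>R\<^esub> m)) a b \<noteq> {} \<longrightarrow>
            (\<exists>x. generating_solution (R Quot (PIdl\<^bsub>R\<^esub> m)) a b x)) \<and>
         (solutions (R Quot (PIdl\<^bsub>R\<^esub> m)) a b \<noteq> {} \<longrightarrow>
            (\<forall>x y. generating_solution (R Quot (PIdl\<^bsub>R\<^esub> m)) a b x \<longrightarrow>
                   generating_solution (R Quot (PIdl\<^bsub>R\<^esub> m)) a b y \<longrightarrow>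
                   unit_associates (R Quot (PIdl\<^bsub>R\<^esub> m)) x y))"
proof -
  interpret bezout_domain R by fact
  interpret principal_quotient R m "R Quot (PIdl\<^bsub>R\<^esub> m)" "\<lambda>x. PIdl\<^bsub>R\<^esub> m +>\<^bsub>R\<^esub> x"
    by unfold_locales (use assms(3,4) in auto)
  show ?thesis
  proof (intro conjI impI allI)
    assume "solutions (R Quot (PIdl\<^bsub>R\<^esub> m)) a b \<noteq> {}"
    then show "\<exists>x. generating_solution (R Quot (PIdl\<^bsub>R\<^esub> m)) a b x"
      using ex_generating_solution assms by blast
  next
    fix x y
    assume "generating_solution (R Quot (PIdl\<^bsub>R\<^esub> m)) a b x" "generating_solution (R Quot (PIdl\<^bsub>R\<^esub> m)) a b y"
    then show "unit_associates (R Quot (PIdl\<^bsub>R\<^esub> m)) x y"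
      unfolding generating_solution_def
      by (intro mutual_divisors_unit_associates assms(2)) (auto simp: solutions_def)
  qed
qed

end
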